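(* For every integer $n\ge 4$ and every integer $i$, \[|\mathcal{C}_{n}^{i}|=|\mathcal{C}_{n-1}^{i-1}|+|\mathcal{C}_{n-2}^{i-1}|+|\mathcal{C}_{n-3}^{i-1}|.\]
   Context: For an integer $m\ge 3$, $C_m$ denotes the cycle with vertex set $[m]=\{1,2,\dots,m\}$ and edge set $\{\{1,2\},\{2,3\},\dots,\{m-1,m\},\{m,1\}\}$; by convention $C_1$ is the graph with the single vertex $1$, and $C_2$ is the graph on $\{1,2\}$ with the single edge $\{1,2\}$. A set $S$ of vertices of a graph $G$ is a dominating set if every vertex not in $S$ is adjacent to at least one vertex of $S$. For $m\ge1$ and an integer $j$, $\mathcal{C}_m^j$ denotes the family of dominating sets of $C_m$ of cardinality $j$ (so it is empty if $j<0$ or $j>m$). *)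

theory Defs
  imports Main
begin

text \<open>A simple graph is a pair of its vertex set and its set of (two-element) edges.\<close>

type_synonym 'a graph = "'a set \<times> 'a set set"

definition verts :: "'a graph \<Rightarrow> 'a set" where
  "verts G = fst G"

definition edges :: "'a graph \<Rightarrow> 'a set set" where
  "edges G = snd G"

definition adjacent :: "'a graph \<Rightarrow> 'a \<Rightarrow> 'a \<Rightarrow> bool" where
  "adjacent G u v \<longleftrightarrow> {u, v} \<in> edges G"

definition dominating_set :: "'a graph \<Rightarrow> 'a set \<Rightarrow> bool" where
  "dominating_set G S \<longleftrightarrow> S \<subseteq> verts G \<and> (\<forall>v \<in> verts G - S. \<exists>u \<in> S. adjacent G v u)"

text \<open>The cases \<open>m = 1\<close> and \<open>m = 2\<close> follow the convention that these degenerate cycles are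
  a single vertex and a single edge; \<open>m = 0\<close> is a junk value (the empty graph).\<close>

definition cycle_graph :: "nat \<Rightarrow> nat graph" where
  "cycle_graph m =
    ({1..m},
     if m \<ge> 3 then {{k, k + 1} | k. 1 \<le> k \<and> k < m} \<union> {{m, 1}}
     else if m = 2 then {{1, 2}}
     else {})"

text \<open>The cardinality \<open>j\<close> is an integer, so the family is empty for negative \<open>j\<close>.\<close>

definition cycle_dominating_sets :: "nat \<Rightarrow> int \<Rightarrow> nat set set" where
  "cycle_dominating_sets m j = {S. dominating_set (cycle_graph m) S \<and> int (card S) = j}"

end

theory Submission
  imports Defs
begin

text \<open>A set \<open>S\<close> dominates the cycle iff, going around the cycle, any two consecutive elements of
  \<open>S\<close> are at distance at most 3. Deleting the last gap \<open>g \<in> {1, 2, 3}\<close> before \<open>Max S\<close>, together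
  with the element \<open>Max S\<close>, therefore leaves a dominating set of the cycle shortened by \<open>g\<close>, and
  every dominating set \<open>T\<close> of that cycle arises once, from \<open>insert (Max T + g) T\<close>. For \<open>n \<ge> 4\<close>
  a dominating set has at least two elements, so this exhausts the dominating sets of the
  \<open>n\<close>-cycle.\<close>

section \<open>Domination as a bound on cyclic gaps\<close>

text \<open>The second disjunct says that the gap after \<open>v\<close> wraps around past the vertex \<open>m\<close>.\<close>

definition cyclic_gaps_le_3 :: "nat \<Rightarrow> nat set \<Rightarrow> bool" where
  "cyclic_gaps_le_3 m S \<longleftrightarrow> S \<subseteq> {1..m} \<and> S \<noteq> {} \<and>
    (\<forall>v\<in>S. \<exists>u\<in>S. (v < u \<and> u \<le> v + 3) \<or> u + m \<le> v + 3)"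

lemma adjacent_cycle_graph_iff:
  assumes "m \<ge> 3"
  shows "adjacent (cycle_graph m) u v \<longleftrightarrow>
    (1 \<le> u \<and> u < m \<and> v = u + 1) \<or> (1 \<le> v \<and> v < m \<and> u = v + 1) \<or>
    (u = m \<and> v = 1) \<or> (u = 1 \<and> v = m)"
  using assms by (auto simp: adjacent_def edges_def cycle_graph_def doubleton_eq_iff)

lemma verts_cycle_graph [simp]: "verts (cycle_graph m) = {1..m}"
  by (simp add: verts_def cycle_graph_def)

text \<open>Whatever dominates the vertex two steps after \<open>v\<close> lies one, two or three
  steps after \<open>v\<close>. The three cases locate that vertex: it is \<open>v + 2\<close> or,
  after wrapping, \<open>1\<close> or \<open>2\<close>.\<close>

lemma cyclic_gaps_le_3_if_dominating:
  assumes m: "m \<ge> 3" and dom: "dominating_set (cycle_graph m) S"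
  shows "cyclic_gaps_le_3 m S"
proof -
  have sub: "S \<subseteq> {1..m}"
    using dom by (simp add: dominating_set_def)
  have near: "\<exists>u\<in>S. u = w \<or> u = w + 1 \<or> w = u + 1 \<or> (w = m \<and> u = 1) \<or> (w = 1 \<and> u = m)"
    if "w \<in> {1..m}" for w
  proof (cases "w \<in> S")
    case False
    with that dom obtain u where "u \<in> S" "adjacent (cycle_graph m) w u"
      unfolding dominating_set_def verts_cycle_graph by blast
    then show ?thesis
      using adjacent_cycle_graph_iff[OF m] by blast
  qed blast
  have "S \<noteq> {}"
    using near[of 1] m by auto
  moreover have "\<exists>u\<in>S. (v < u \<and> u \<le> v + 3) \<or> u + m \<le> v + 3" if "v \<in> S" for v
  proof -
    have v: "1 \<le> v" "v \<le> m"
      using that sub by auto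
    consider "v + 2 \<le> m" | "v + 1 = m" | "v = m"
      using v by linarith
    then show ?thesis
    proof cases
      case 1
      then obtain u where "u \<in> S" "u = v + 2 \<or> u = v + 3 \<or> v + 2 = u + 1 \<or> (v + 2 = m \<and> u = 1)"
        using near[of "v + 2"] v by auto
      then show ?thesis
        by (intro bexI[of _ u]) auto
    next
      case 2
      then obtain u where "u \<in> S" "u = 1 \<or> u = 2 \<or> u = m"
        using near[of 1] sub m by fastforce
      then show ?thesis
        using 2 by (intro bexI[of _ u]) auto
    next
      case 3
      then obtain u where "u \<in> S" "u \<le> 3"
        using near[of 2] m by fastforce
      then show ?thesis
        using 3 by (intro bexI[of _ u]) auto
    qed
  qed
  ultimately show ?thesis
    using sub by (auto simp: cyclic_gaps_le_3_def)
qed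

text \<open>A vertex outside \<open>S\<close> lies strictly inside a gap of length at most 3, hence
  next to one of the two ends of that gap.\<close>

lemma dominating_if_cyclic_gaps_le_3:
  assumes m: "m \<ge> 3" and gaps: "cyclic_gaps_le_3 m S"
  shows "dominating_set (cycle_graph m) S"
proof -
  have sub: "S \<subseteq> {1..m}" and ne: "S \<noteq> {}"
    and step: "\<And>v. v \<in> S \<Longrightarrow> \<exists>u\<in>S. (v < u \<and> u \<le> v + 3) \<or> u + m \<le> v + 3"
    using gaps by (auto simp: cyclic_gaps_le_3_def)
  have fin: "finite S"
    using sub finite_subset by blast
  have "\<exists>u\<in>S. adjacent (cycle_graph m) w u" if w: "w \<in> {1..m}" "w \<notin> S" for w
  proof (cases "\<exists>v\<in>S. v + 2 \<le> w")
    case True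
    \<comment> \<open>By maximality, a step from \<open>v\<close> that does not wrap ends at
      \<open>w - 1\<close> or \<open>w + 1\<close>; one that wraps forces \<open>w = m\<close> and
      ends at \<open>1\<close>.\<close>
    define v where "v = Max {v \<in> S. v + 2 \<le> w}"
    have v: "v \<in> S" "v + 2 \<le> w"
      using Max_in[of "{v \<in> S. v + 2 \<le> w}"] True fin by (auto simp: v_def)
    have v_max: "x \<le> v" if "x \<in> S" "x + 2 \<le> w" for x
      using that fin by (auto simp: v_def)
    obtain u where u: "u \<in> S" "(v < u \<and> u \<le> v + 3) \<or> u + m \<le> v + 3"
      using step v(1) by blast
    have "1 \<le> u" "u \<le> m" "u \<noteq> w"
      using u(1) sub w by auto
    moreover have "u + 1 = w \<or> u = w + 1 \<or> (w = m \<and> u = 1)"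
      using u v v_max[of u] w calculation by (cases "u + 2 \<le> w") auto
    ultimately have "adjacent (cycle_graph m) w u"
      using w by (auto simp: adjacent_cycle_graph_iff[OF m])
    then show ?thesis
      using u(1) by blast
  next
    case False
    have M: "Max S \<in> S" "Max S \<le> m"
      using Max_in[OF fin ne] sub by auto
    obtain u where u: "u \<in> S" "(Max S < u \<and> u \<le> Max S + 3) \<or> u + m \<le> Max S + 3"
      using step M(1) by blast
    moreover have "u \<le> Max S"
      using u(1) fin by simp
    ultimately have um: "u + m \<le> Max S + 3"
      by auto
    have "1 \<le> u" "u \<le> m" "u \<noteq> w" "w < u + 2"
      using u(1) sub w False by auto
    \<comment> \<open>The exception is \<open>u = 3\<close> with \<open>w = 1\<close>: the wrapping
      gap then has length 3, and \<open>w\<close> is next to its other end \<open>m\<close>.\<close>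
    then have "adjacent (cycle_graph m) w u \<or> (w = 1 \<and> Max S = m)"
      using w um M by (auto simp: adjacent_cycle_graph_iff[OF m])
    then show ?thesis
      using u(1) M(1) by (auto simp: adjacent_cycle_graph_iff[OF m])
  qed
  then show ?thesis
    using sub by (auto simp: dominating_set_def)
qed

text \<open>For \<open>m = 1\<close> and \<open>m = 2\<close> both sides say that \<open>S\<close>
  is a nonempty set of vertices, since each \<open>v\<close> meets the gap condition with
  \<open>u = v\<close>. These cycles occur in the recurrence for \<open>n = 4\<close> and
  \<open>n = 5\<close>.\<close>

lemma dominating_cycle_graph_iff:
  assumes "m \<ge> 1"
  shows "dominating_set (cycle_graph m) S \<longleftrightarrow> cyclic_gaps_le_3 m S"
proof (cases "m \<ge> 3")
  case True
  then show ?thesis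
    using cyclic_gaps_le_3_if_dominating dominating_if_cyclic_gaps_le_3 by blast
next
  case False
  then consider "m = 1" | "m = 2"
    using assms by linarith
  then show ?thesis
  proof cases
    case 1
    have "{1..1::nat} = {1}"
      by auto
    then show ?thesis
      using 1 by (auto simp: dominating_set_def cyclic_gaps_le_3_def)
  next
    case 2
    have adj: "adjacent (cycle_graph 2) 1 2" "adjacent (cycle_graph 2) 2 1"
      by (auto simp: adjacent_def edges_def cycle_graph_def)
    have V: "{1..2::nat} = {1, 2}"
      by auto
    show ?thesis
    proof (cases "S \<subseteq> {1, 2}")
      case True
      then have "S \<in> {{}, {1}, {2}, {1, 2}}"
        by auto
      then show ?thesis
        unfolding 2 dominating_set_def cyclic_gaps_le_3_def verts_cycle_graph V
        using adj by auto
    next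
      case False
      then show ?thesis
        unfolding 2 dominating_set_def cyclic_gaps_le_3_def verts_cycle_graph V by blast
    qed
  qed
qed

section \<open>Appending and deleting the last gap\<close>

lemma cyclic_gaps_le_3_finite: "cyclic_gaps_le_3 m S \<Longrightarrow> finite S"
  unfolding cyclic_gaps_le_3_def using finite_subset by blast

text \<open>Nothing in \<open>S\<close> exceeds \<open>Max S\<close>, so its gap condition can only
  be met by wrapping.\<close>

lemma cyclic_gaps_le_3_Max:
  assumes "cyclic_gaps_le_3 m S"
  shows "Max S \<in> S" "Max S \<le> m" "\<exists>u\<in>S. u + m \<le> Max S + 3"
proof -
  have fin: "finite S"
    using assms by (rule cyclic_gaps_le_3_finite)
  show M: "Max S \<in> S" and "Max S \<le> m"
    using assms Max_in[OF fin] by (auto simp: cyclic_gaps_le_3_def)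
  obtain u where "u \<in> S" "(Max S < u \<and> u \<le> Max S + 3) \<or> u + m \<le> Max S + 3"
    using assms M by (auto simp: cyclic_gaps_le_3_def)
  then show "\<exists>u\<in>S. u + m \<le> Max S + 3"
    using Max_ge[OF fin] by (metis leD)
qed

definition append_gap :: "nat \<Rightarrow> nat set \<Rightarrow> nat set" where
  "append_gap g T = insert (Max T + g) T"

lemma Max_append_gap:
  assumes "finite T" "T \<noteq> {}"
  shows "Max (append_gap g T) = Max T + g"
  using assms by (simp add: append_gap_def)

text \<open>As \<open>g \<ge> 1\<close>, the added element is new and is the maximum. Recovering
  \<open>T\<close> in this way gives injectivity in the count.\<close>

lemma append_gap_remove_Max:
  assumes "finite T" "T \<noteq> {}" "g \<ge> 1"
  shows "append_gap g T - {Max (append_gap g T)} = T"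
proof -
  have "Max T + g \<notin> T"
    using assms Max_ge[of T "Max T + g"] by auto
  then show ?thesis
    using assms by (simp add: Max_append_gap) (simp add: append_gap_def)
qed

lemma card_append_gap:
  assumes "finite T" "T \<noteq> {}" "g \<ge> 1"
  shows "card (append_gap g T) = card T + 1"
proof -
  have "Max T + g \<notin> T"
    using assms Max_ge[of T "Max T + g"] by auto
  then show ?thesis
    using assms by (simp add: append_gap_def)
qed

text \<open>The new element takes over the wrapping gap of \<open>Max T\<close>, whose length is
  unchanged because the cycle grows by the same \<open>g\<close>.\<close>

lemma cyclic_gaps_le_3_append_gap:
  assumes g: "1 \<le> g" "g \<le> 3" and T: "cyclic_gaps_le_3 m T"
  shows "cyclic_gaps_le_3 (m + g) (append_gap g T)"
proof -
  note M = cyclic_gaps_le_3_Max[OF T]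
  have Tsub: "T \<subseteq> {1..m}"
    using T by (simp add: cyclic_gaps_le_3_def)
  have "\<exists>u\<in>append_gap g T. (v < u \<and> u \<le> v + 3) \<or> u + (m + g) \<le> v + 3"
    if v: "v \<in> append_gap g T" for v
  proof -
    have "v \<le> Max T" if "v \<in> T"
      using that cyclic_gaps_le_3_finite[OF T] by simp
    then consider "v = Max T + g" | "v = Max T" | "v \<in> T" "v < Max T"
      using v unfolding append_gap_def by (metis insertE le_neq_implies_less)
    then show ?thesis
    proof cases
      case 1
      then show ?thesis
        using M(3) by (auto simp: append_gap_def)
    next
      case 2
      then show ?thesis
        using g by (auto simp: append_gap_def)
    next
      case 3
      obtain u where u: "u \<in> T" "(v < u \<and> u \<le> v + 3) \<or> u + m \<le> v + 3"
        using T 3(1) by (auto simp: cyclic_gaps_le_3_def)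
      show ?thesis
      proof (cases "v < u \<and> u \<le> v + 3")
        case True
        then show ?thesis
          using u(1) by (auto simp: append_gap_def)
      next
        case False
        \<comment> \<open>A wrap from \<open>v < Max T\<close> may become too long in the larger
          cycle, but it forces \<open>m \<le> v + 3\<close>, so \<open>Max T\<close> can serve as
          the witness instead.\<close>
        then have "Max T \<le> v + 3"
          using u M(2) by auto
        then show ?thesis
          using 3 M(1) by (auto simp: append_gap_def)
      qed
    qed
  qed
  moreover have "append_gap g T \<subseteq> {1..m + g}"
    using Tsub M g by (auto simp: append_gap_def)
  ultimately show ?thesis
    by (auto simp: cyclic_gaps_le_3_def append_gap_def)
qed

text \<open>This inverts appending: \<open>T\<close> is \<open>S\<close> without its maximum, and
  \<open>g\<close> is the distance between the two largest elements.\<close>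

lemma cyclic_gaps_le_3_split:
  assumes n: "n \<ge> 4" and S: "cyclic_gaps_le_3 n S"
  obtains g T where "1 \<le> g" "g \<le> 3" "g < n" "cyclic_gaps_le_3 (n - g) T" "S = append_gap g T"
proof -
  define M where "M = Max S"
  define T where "T = S - {M}"
  define M' where "M' = Max T"
  define g where "g = M - M'"
  have fin: "finite S"
    using S by (rule cyclic_gaps_le_3_finite)
  have sub: "S \<subseteq> {1..n}"
    and step: "\<And>v. v \<in> S \<Longrightarrow> \<exists>u\<in>S. (v < u \<and> u \<le> v + 3) \<or> u + n \<le> v + 3"
    using S by (auto simp: cyclic_gaps_le_3_def)
  have M: "M \<in> S" "M \<le> n" and M_ge: "\<And>x. x \<in> S \<Longrightarrow> x \<le> M"
    using cyclic_gaps_le_3_Max[OF S] fin by (auto simp: M_def)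
  obtain w where w: "w \<in> S" "w + n \<le> M + 3"
    using cyclic_gaps_le_3_Max(3)[OF S] by (auto simp: M_def)
  \<comment> \<open>Since \<open>n \<ge> 4\<close>, the bound \<open>w + n \<le> M + 3\<close> gives
    \<open>w < M\<close>; this second element makes \<open>T\<close> nonempty.\<close>
  then have wT: "w \<in> T"
    using n by (auto simp: T_def)
  have M': "M' \<in> T" and M'_ge: "\<And>x. x \<in> T \<Longrightarrow> x \<le> M'"
    using wT fin Max_in[of T] by (auto simp: M'_def T_def)
  have M'M: "M' < M" and M'1: "1 \<le> M'"
    using M' M_ge[of M'] sub by (auto simp: T_def)
  have g: "1 \<le> g" "g < n" "M = M' + g"
    using M'M M'1 M(2) by (auto simp: g_def)
  obtain u where u: "u \<in> S" "(M' < u \<and> u \<le> M' + 3) \<or> u + n \<le> M' + 3"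
    using step[of M'] M' by (auto simp: T_def)
  \<comment> \<open>If \<open>u\<close> is not \<open>M\<close>, then \<open>u \<le> M'\<close>, so
    the step wraps and \<open>M \<le> n \<le> M' + 3\<close>.\<close>
  have "M \<le> M' + 3"
    using u M(2) M'_ge[of u] by (cases "u = M") (auto simp: T_def)
  then have g3: "g \<le> 3"
    by (simp add: g_def)
  have "\<exists>u\<in>T. (v < u \<and> u \<le> v + 3) \<or> u + (n - g) \<le> v + 3" if v: "v \<in> T" for v
  proof (cases "v = M'")
    case True
    \<comment> \<open>\<open>M'\<close> inherits the wrap of \<open>M\<close>, because
      \<open>w + n \<le> M + 3 = M' + g + 3\<close>.\<close>
    then show ?thesis
      using wT w g by (intro bexI[of _ w]) auto
  next
    case False
    then have v_less: "v < M'"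
      using M'_ge[OF v] by simp
    obtain u where u: "u \<in> S" "(v < u \<and> u \<le> v + 3) \<or> u + n \<le> v + 3"
      using step[of v] v by (auto simp: T_def)
    show ?thesis
    proof (cases "u = M")
      case True
      \<comment> \<open>A step to the deleted \<open>M\<close> is redirected to \<open>M'\<close>,
        which lies between \<open>v\<close> and \<open>M\<close>. All other steps survive, since
        shortening the cycle relaxes the wrap condition.\<close>
      then have "M' \<le> v + 3"
        using u M'M by auto
      then show ?thesis
        using M' v_less by blast
    next
      case False
      then show ?thesis
        using u g by (intro bexI[of _ u]) (auto simp: T_def)
    qed
  qed
  moreover have "T \<subseteq> {1..n - g}"
  proof
    fix x assume "x \<in> T"
    then show "x \<in> {1..n - g}"
      using M'_ge[of x] sub g M(2) by (auto simp: T_def)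
  qed
  ultimately have "cyclic_gaps_le_3 (n - g) T"
    using wT by (auto simp: cyclic_gaps_le_3_def)
  moreover have "S = append_gap g T"
  proof -
    have "S = insert M T"
      using M(1) by (auto simp: T_def)
    then show ?thesis
      using g(3) by (simp add: append_gap_def flip: M'_def)
  qed
  ultimately show ?thesis
    using that g g3 by blast
qed

section \<open>Counting the dominating sets\<close>

lemma cycle_dominating_sets_eq:
  assumes "m \<ge> 1"
  shows "cycle_dominating_sets m j = {S. cyclic_gaps_le_3 m S \<and> int (card S) = j}"
  using assms by (simp add: cycle_dominating_sets_def dominating_cycle_graph_iff)

text \<open>At \<open>m = 0\<close> the empty set dominates the empty graph, hence the bound on
  \<open>m\<close>. Nonemptiness keeps \<open>Max\<close> meaningful in
  \<open>append_gap\<close>.\<close>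

lemma cycle_dominating_sets_nonempty:
  assumes "m \<ge> 1" "T \<in> cycle_dominating_sets m j"
  shows "finite T" "T \<noteq> {}"
  using assms cyclic_gaps_le_3_finite
  by (auto simp: cycle_dominating_sets_eq cyclic_gaps_le_3_def)

lemma finite_cycle_dominating_sets: "finite (cycle_dominating_sets m j)"
  by (rule finite_subset[of _ "Pow {1..m}"])
    (auto simp: cycle_dominating_sets_def dominating_set_def)

text \<open>The two inclusions are splitting and appending; the cardinality drops by one whatever
  \<open>g\<close> is, as a single element is deleted.\<close>

lemma cycle_dominating_sets_decomp:
  assumes n: "n \<ge> 4"
  shows "cycle_dominating_sets n i =
    (\<Union>g\<in>{1..3}. append_gap g ` cycle_dominating_sets (n - g) (i - 1))"
proof (intro equalityI subsetI)
  fix S assume "S \<in> cycle_dominating_sets n i"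
  then have S: "cyclic_gaps_le_3 n S" "int (card S) = i"
    using n by (auto simp: cycle_dominating_sets_eq)
  obtain g T where g: "1 \<le> g" "g \<le> 3" "g < n" and T: "cyclic_gaps_le_3 (n - g) T"
    and ST: "S = append_gap g T"
    using cyclic_gaps_le_3_split[OF n S(1)] .
  have "T \<noteq> {}"
    using T by (simp add: cyclic_gaps_le_3_def)
  then have "T \<in> cycle_dominating_sets (n - g) (i - 1)"
    using T g S(2) card_append_gap[OF cyclic_gaps_le_3_finite[OF T]]
    by (auto simp: cycle_dominating_sets_eq ST)
  then show "S \<in> (\<Union>g\<in>{1..3}. append_gap g ` cycle_dominating_sets (n - g) (i - 1))"
    using g ST by auto
next
  fix S assume "S \<in> (\<Union>g\<in>{1..3}. append_gap g ` cycle_dominating_sets (n - g) (i - 1))"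
  then obtain g T where g: "1 \<le> g" "g \<le> 3"
    and T: "T \<in> cycle_dominating_sets (n - g) (i - 1)" and ST: "S = append_gap g T"
    by auto
  \<comment> \<open>With \<open>n \<ge> 4\<close> and \<open>g \<le> 3\<close> at least the
    one-vertex cycle remains, so the junk value at length 0 never enters.\<close>
  have ng: "n - g \<ge> 1" "n - g + g = n"
    using n g by auto
  have "cyclic_gaps_le_3 n S"
    using cyclic_gaps_le_3_append_gap[OF g, of "n - g" T] T ng
    by (simp add: cycle_dominating_sets_eq ST)
  moreover have "int (card S) = i"
    using card_append_gap[OF cycle_dominating_sets_nonempty[OF ng(1) T] g(1)] T
    by (simp add: cycle_dominating_sets_def ST)
  ultimately show "S \<in> cycle_dominating_sets n i"
    using n by (simp add: cycle_dominating_sets_eq)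
qed

theorem theorem2:
  fixes n :: nat and i :: int
  assumes "n \<ge> 4"
  shows "card (cycle_dominating_sets n i) =
    card (cycle_dominating_sets (n - 1) (i - 1)) +
    card (cycle_dominating_sets (n - 2) (i - 1)) +
    card (cycle_dominating_sets (n - 3) (i - 1))"
proof -
  let ?D = "\<lambda>g. cycle_dominating_sets (n - g) (i - 1)"
  have ne: "finite T" "T \<noteq> {}" if "T \<in> ?D g" "g \<in> {1..3}" for g T
  proof -
    have "n - g \<ge> 1"
      using that(2) assms by auto
    then show "finite T" "T \<noteq> {}"
      using cycle_dominating_sets_nonempty that(1) by blast+
  qed
  \<comment> \<open>Deleting the maximum gives \<open>T = U\<close>, and comparing maxima then gives
    \<open>g = h\<close>. This serves both for disjointness of the three images and for injectivity
    on each of them.\<close>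
  have same: "g = h \<and> T = U"
    if g: "g \<in> {1..3}" and h: "h \<in> {1..3}" and T: "T \<in> ?D g" and U: "U \<in> ?D h"
      and eq: "append_gap g T = append_gap h U" for g h T U
  proof -
    have g1: "g \<ge> 1" and h1: "h \<ge> 1"
      using g h by auto
    have "T = append_gap g T - {Max (append_gap g T)}"
      using append_gap_remove_Max[OF ne[OF T g] g1] by (rule sym)
    also have "\<dots> = U"
      unfolding eq by (rule append_gap_remove_Max[OF ne[OF U h] h1])
    finally have TU: "T = U" .
    have "Max T + g = Max U + h"
      using Max_append_gap[OF ne[OF T g], of g] Max_append_gap[OF ne[OF U h], of h]
      unfolding eq by (rule trans[OF sym])
    then show ?thesis
      using TU by simp
  qed
  have "card (cycle_dominating_sets n i) = (\<Sum>g\<in>{1..3}. card (append_gap g ` ?D g))"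
    unfolding cycle_dominating_sets_decomp[OF assms]
  proof (rule card_UN_disjoint)
    show "\<forall>g\<in>{1..3}. \<forall>h\<in>{1..3}. g \<noteq> h \<longrightarrow> append_gap g ` ?D g \<inter> append_gap h ` ?D h = {}"
    proof (intro ballI impI equals0I)
      fix g h S
      assume gh: "g \<in> {1..3}" "h \<in> {1..3}" "g \<noteq> h"
        and "S \<in> append_gap g ` ?D g \<inter> append_gap h ` ?D h"
      then obtain T U where "T \<in> ?D g" "U \<in> ?D h" "append_gap g T = append_gap h U"
        by (elim IntE imageE) simp
      then show False
        using same[OF gh(1,2)] gh(3) by simp
    qed
  qed (simp_all add: finite_cycle_dominating_sets)
  also have "\<dots> = (\<Sum>g\<in>{1..3}. card (?D g))"
  proof (intro sum.cong refl card_image inj_onI)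
    fix g T U
    assume g: "g \<in> {1..3}" and "T \<in> ?D g" "U \<in> ?D g" "append_gap g T = append_gap g U"
    then show "T = U"
      using same[OF g g] by simp
  qed
  also have "\<dots> = card (?D 1) + card (?D 2) + card (?D 3)"
  proof -
    have "{1..3::nat} = {1, 2, 3}"
      by auto
    then show ?thesis
      by simp
  qed
  finally show ?thesis .
qed

end
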